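(* Let $\delta,a,K\in\mathbb{N}$ with $2\le a\le K-2$, and let $F$ be the update rule of the reaction-diffusion cellular automaton determined by $\delta$ and the maximal bistable reaction function $f=f^{a,K}_{\max}$, where $f^{a,K}_{\max}(u)=0$ for $u<a$, $f^{a,K}_{\max}(a)=a$, and $f^{a,K}_{\max}(u)=K$ for $u>a$. (1) If $\delta\le\min\{a-1,K-a-1\}$, there exists a pinned wave. (2) If $a\in\left\{\lfloor \frac K2\rfloor,\lceil\frac K2\rceil\right\}$ and (a) $K=4m-1$ for some $m\in\mathbb{N}$, then there exists a higher-order $(\pm1,2)$-traveling wave for all $\delta\ge\min\{a,K-a\}$; (b) $K$ is not of the form $4m-1$ with $m\in\mathbb{N}$, then there exists a pinned wave for all $\delta\ge\min\{a,K-a\}$. (3) If $a\notin\left\{\lfloor \frac K2\rfloor,\lceil\frac K2\rceil\right\}$ and (a) $\delta=\min\{a,K-a\}$, then there exists a higher-order $(\pm1,2)$-traveling wave; (b) $\delta\ge\min\{a+1,K-a+1\}$, then there exists a traveling wave with $c=\pm1$. Here "$\pm1$" means that the statement holds with $c=1$ or with $c=-1$.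
   Context: $\mathbb{N}=\{1,2,\dots\}$, $\mathbb{N}_0=\mathbb{N}\cup\{0\}$. For $\delta\in\mathbb{N}$ define $h_\delta(m,n)\in\mathbb{Z}$ for $m,n\in\mathbb{N}_0$ by: $h_\delta(m,n)=\delta$ if $m-n\ge 2\delta$; $h_\delta(m,n)=-\delta$ if $m-n\le -2\delta$; for $j=1,\dots,\delta-1$, $h_\delta(m,n)=j$ if $m-n\in\{2j,2j+1\}$ and $h_\delta(m,n)=-j$ if $n-m\in\{2j,2j+1\}$; and $h_\delta(m,n)=0$ otherwise. The reaction-diffusion cellular automaton determined by $\delta$ and $f:\mathbb{N}_0\to\mathbb{N}_0$ is $u(t+1)=F(u(t))$, $t\in\mathbb{N}_0$, where for $u\in\mathbb{N}_0^{\mathbb{Z}}$, $n\in\mathbb{Z}$, $$F(u)_n=f(u_n)+h_\delta(f(u_{n-1}),f(u_n))+h_\delta(f(u_{n+1}),f(u_n)).$$ A wave profile is a sequence $w=(w_n)_{n\in\mathbb{Z}}$ of nonnegative integers for which there is $N\in\mathbb{N}$ with $w_n=0$ for $n\le 0$, $w_n=K$ for $n\ge N$, and $0=w_0<w_1\le w_2\le\dots\le w_{N-1}<w_N=K$. A traveling wave with speed $c\in\mathbb{Z}$ is a wave profile $w$ with $F(w)_n=w_{n-c}$ for all $n\in\mathbb{Z}$; it is called pinned if $c=0$. For $c\in\mathbb{Z}$, $m\in\mathbb{N}$, a wave profile $w$ forms a higher-order $(c,m)$-traveling wave if $F^m(w)_n=w_{n-c}$ for all $n\in\mathbb{Z}$,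 where $F^m$ is the $m$-fold iterate of $F$. *)

theory Defs
  imports Complex_Main
begin

(* The flow h_delta(m,n); the j selected by THE is unique, cf. diff_flow_closed_form. *)
definition diff_flow :: "nat \<Rightarrow> nat \<Rightarrow> nat \<Rightarrow> int" where
  "diff_flow \<delta> m n =
    (let d = int m - int n in
     if d \<ge> 2 * int \<delta> then int \<delta>
     else if d \<le> - 2 * int \<delta> then - int \<delta>
     else if \<exists>j\<in>{1..int \<delta> - 1}. d \<in> {2*j, 2*j+1}
       then (THE j. j \<in> {1..int \<delta> - 1} \<and> d \<in> {2*j, 2*j+1})
     else if \<exists>j\<in>{1..int \<delta> - 1}. - d \<in> {2*j, 2*j+1}
       then - (THE j. j \<in> {1..int \<delta> - 1} \<and> - d \<in> {2*j, 2*j+1})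
     else 0)"

(* The value is computed in the integers and is never negative (lemma int_rdca_step),
   so the conversion by nat loses nothing. *)
definition rdca_step :: "nat \<Rightarrow> (nat \<Rightarrow> nat) \<Rightarrow> (int \<Rightarrow> nat) \<Rightarrow> int \<Rightarrow> nat" where
  "rdca_step \<delta> f u n =
    nat (int (f (u n)) + diff_flow \<delta> (f (u (n - 1))) (f (u n))
                       + diff_flow \<delta> (f (u (n + 1))) (f (u n)))"

definition fmax :: "nat \<Rightarrow> nat \<Rightarrow> nat \<Rightarrow> nat" where
  "fmax a K u = (if u < a then 0 else if u = a then a else K)"

(* For N = 1 the chain 0 = w 0 < w 1 \<le> ... \<le> w (N - 1) < w N = K is read as
   0 = w 0 < w 1 = K. *)
definition wave_profile :: "nat \<Rightarrow> (int \<Rightarrow> nat) \<Rightarrow> bool" where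
  "wave_profile K w \<longleftrightarrow>
    (\<exists>N::int. N \<ge> 1 \<and> (\<forall>n\<le>0. w n = 0) \<and> (\<forall>n\<ge>N. w n = K) \<and>
       w 0 < w 1 \<and> (\<forall>n. 1 \<le> n \<and> n + 1 \<le> N - 1 \<longrightarrow> w n \<le> w (n + 1)) \<and> w (N - 1) < w N)"

definition traveling_wave ::
  "((int \<Rightarrow> nat) \<Rightarrow> int \<Rightarrow> nat) \<Rightarrow> nat \<Rightarrow> int \<Rightarrow> (int \<Rightarrow> nat) \<Rightarrow> bool" where
  "traveling_wave F K c w \<longleftrightarrow> wave_profile K w \<and> (\<forall>n. F w n = w (n - c))"

definition pinned_wave ::
  "((int \<Rightarrow> nat) \<Rightarrow> int \<Rightarrow> nat) \<Rightarrow> nat \<Rightarrow> (int \<Rightarrow> nat) \<Rightarrow> bool" where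
  "pinned_wave F K w \<longleftrightarrow> traveling_wave F K 0 w"

definition higher_order_wave ::
  "((int \<Rightarrow> nat) \<Rightarrow> int \<Rightarrow> nat) \<Rightarrow> nat \<Rightarrow> int \<Rightarrow> nat \<Rightarrow> (int \<Rightarrow> nat) \<Rightarrow> bool" where
  "higher_order_wave F K c m w \<longleftrightarrow> wave_profile K w \<and> (\<forall>n. (F ^^ m) w n = w (n - c))"

lemma diff_flow_closed_form:
  "diff_flow \<delta> m n =
    (if m \<ge> n then min (int \<delta>) ((int m - int n) div 2)
     else - min (int \<delta>) ((int n - int m) div 2))"
proof -
  have the_eq: "(THE j. j \<in> {1..int \<delta> - 1} \<and> x \<in> {2*j, 2*j+1}) = x div 2"
    if "\<exists>j\<in>{1..int \<delta> - 1}. x \<in> {2*j, 2*j+1}" for x :: int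
    using that by (intro the_equality) auto
  have ex_iff: "(\<exists>j\<in>{1..int \<delta> - 1}. x \<in> {2*j, 2*j+1}) \<longleftrightarrow> 2 \<le> x \<and> x < 2 * int \<delta>" for x :: int
  proof
    assume "\<exists>j\<in>{1..int \<delta> - 1}. x \<in> {2*j, 2*j+1}"
    then show "2 \<le> x \<and> x < 2 * int \<delta>" by auto
  next
    assume "2 \<le> x \<and> x < 2 * int \<delta>"
    then have "x div 2 \<in> {1..int \<delta> - 1}" "x \<in> {2 * (x div 2), 2 * (x div 2) + 1}" by auto
    then show "\<exists>j\<in>{1..int \<delta> - 1}. x \<in> {2*j, 2*j+1}" by blast
  qed
  show ?thesis
    unfolding diff_flow_def Let_def
    using the_eq[of "int m - int n"] the_eq[of "- (int m - int n)"]
    by (simp only: ex_iff) (auto simp: min_def)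
qed

lemma int_rdca_step:
  "int (rdca_step \<delta> f u n) =
    int (f (u n)) + diff_flow \<delta> (f (u (n - 1))) (f (u n))
                  + diff_flow \<delta> (f (u (n + 1))) (f (u n))"
proof -
  have low: "2 * diff_flow \<delta> x y \<ge> - int y" for x y
  proof (cases "x \<ge> y")
    case True
    then have "diff_flow \<delta> x y \<ge> 0"
      by (simp add: diff_flow_closed_form min_def pos_imp_zdiv_nonneg_iff)
    then show ?thesis by linarith
  next
    case False
    then have "2 * ((int y - int x) div 2) \<le> int y" by linarith
    with False show ?thesis by (simp add: diff_flow_closed_form min_def)
  qed
  show ?thesis
    unfolding rdca_step_def
    using low[where x = "f (u (n - 1))" and y = "f (u n)"]
      low[where x = "f (u (n + 1))" and y = "f (u n)"] by simp
qed

end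

theory Submission
  imports Defs
begin

text \<open>
  The reaction \<^term>\<open>fmax a K\<close> takes only the values 0, \<open>a\<close> and \<open>K\<close>, so after one reaction
  a monotone profile is a block pattern of zeros, possibly some entries \<open>a\<close>, and then \<open>K\<close>. Two
  such patterns suffice here: the sharp interface \<open>\<dots> 0 0 K K \<dots>\<close> and the interface
  \<open>\<dots> 0 a K K \<dots>\<close> with a single intermediate cell. Write \<open>\<alpha>\<close>, \<open>p\<close>, \<open>q\<close> for the amounts
  that diffuse across a jump of height \<open>K\<close>, \<open>a\<close> and \<open>K - a\<close>, i.e. the minimum of \<open>\<delta>\<close> and half
  the height, rounded down. Diffusion turns the first pattern into \<open>0, \<alpha>, K - \<alpha>, K\<close> and the
  second into \<open>0, p, a - p + q, K - q, K\<close>.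

  Everything depends on how the reaction classifies these values. In the second profile \<open>p\<close>
  always reacts to 0 and \<open>K - q\<close> to \<open>K\<close>, and only the comparison of \<open>p\<close> with \<open>q\<close> matters: the
  intermediate cell survives if \<open>p = q\<close> (a pinned wave), is absorbed into the \<open>K\<close> phase if
  \<open>p < q\<close>, and into the 0 phase if \<open>q < p\<close>. In the first profile there are the following
  possibilities.

  \<^item> \<open>\<alpha> < a < K - \<alpha>\<close>: the sharp interface reproduces itself in place, giving a pinned wave.
  \<^item> \<open>a < \<alpha>\<close> or \<open>K - \<alpha> < a\<close>: the sharp interface moves by one cell in each step.
  \<^item> \<open>\<alpha> = a < K - \<alpha>\<close> or \<open>\<alpha> < a = K - \<alpha>\<close>: an intermediate cell is created, which is absorbed
    in the next step if \<open>p \<noteq> q\<close>; the interface then moves by one cell in two steps.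

  The three parts of the statement arise by evaluating \<open>\<alpha>\<close>, \<open>p\<close> and \<open>q\<close>. If \<open>a\<close> is as close to
  \<open>K/2\<close> as possible and \<open>\<delta>\<close> is large, then \<open>p\<close> and \<open>q\<close> are the rounded halves of two
  numbers of sum \<open>K\<close> that differ by at most one; these halves differ exactly when the smaller
  number is odd and the larger even, that is, when \<open>K = 4m - 1\<close>. In that case
  \<open>\<alpha> = 2m - 1\<close> is the smaller of \<open>a\<close> and \<open>K - a\<close>, so the sharp interface does create an
  intermediate cell.
\<close>

section \<open>Diffusion across an interface\<close>

definition flux :: "nat \<Rightarrow> nat \<Rightarrow> nat" where
  "flux \<delta> d = min \<delta> (d div 2)"

lemma flux_le_half: "2 * flux \<delta> d \<le> d"
proof -
  have "2 * (d div 2) \<le> d" by simp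
  then show ?thesis unfolding flux_def by linarith
qed

lemma flux_mono: "d \<le> e \<Longrightarrow> flux \<delta> d \<le> flux \<delta> e"
  unfolding flux_def by (intro min.mono div_le_mono) auto

lemma flux_pos: "\<delta> \<ge> 1 \<Longrightarrow> d \<ge> 2 \<Longrightarrow> flux \<delta> d \<ge> 1"
  by (simp add: flux_def Suc_le_eq div_greater_zero_iff)

lemma diff_flow_flux:
  "diff_flow \<delta> m n = (if n \<le> m then int (flux \<delta> (m - n)) else - int (flux \<delta> (n - m)))"
  by (auto simp: diff_flow_closed_form flux_def of_nat_min zdiv_int of_nat_diff)

definition short_ramp :: "nat \<Rightarrow> nat \<Rightarrow> int \<Rightarrow> nat" where
  "short_ramp K \<alpha> n = (if n \<le> 0 then 0 else if n = 1 then \<alpha> else if n = 2 then K - \<alpha> else K)"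

definition long_ramp :: "nat \<Rightarrow> nat \<Rightarrow> nat \<Rightarrow> nat \<Rightarrow> int \<Rightarrow> nat" where
  "long_ramp K p b q n =
    (if n \<le> 0 then 0 else if n = 1 then p else if n = 2 then b else if n = 3 then K - q else K)"

text \<open>
  After the reaction only the cells adjacent to a jump exchange mass. The shift places the cells
  1 and 2 of the ramp on the two sides of the jump between \<open>s\<close> and \<open>s + 1\<close>; comparing this
  shift with the position of the interface before the step gives its displacement.
\<close>
lemma rdca_step_sharp_interface:
  assumes "\<And>n. f (u n) = (if n \<le> s then 0 else K)"
  shows "rdca_step \<delta> f u n = short_ramp K (flux \<delta> K) (n - s + 1)"
proof -
  have "n < s \<or> n = s \<or> n = s + 1 \<or> n > s + 1" by linarith
  moreover have "int (K - flux \<delta> K) = int K - int (flux \<delta> K)"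
    using flux_le_half[of \<delta> K] by simp
  moreover have "flux \<delta> 0 = 0" by (simp add: flux_def)
  ultimately have "int (rdca_step \<delta> f u n) = int (short_ramp K (flux \<delta> K) (n - s + 1))"
    unfolding int_rdca_step assms diff_flow_flux short_ramp_def by auto
  then show ?thesis by simp
qed

lemma rdca_step_interface_with_cell:
  assumes "\<And>n. f (u n) = (if n < s then 0 else if n = s then a else K)" and "a \<le> K"
  shows "rdca_step \<delta> f u n =
    long_ramp K (flux \<delta> a) (a - flux \<delta> a + flux \<delta> (K - a)) (flux \<delta> (K - a)) (n - s + 2)"
proof -
  have "n < s - 1 \<or> n = s - 1 \<or> n = s \<or> n = s + 1 \<or> n > s + 1" by linarith
  moreover have "int (a - flux \<delta> a) = int a - int (flux \<delta> a)"
    using flux_le_half[of \<delta> a] by simp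
  moreover have "int (K - flux \<delta> (K - a)) = int K - int (flux \<delta> (K - a))"
    using flux_le_half[of \<delta> "K - a"] by simp
  moreover have "flux \<delta> 0 = 0" by (simp add: flux_def)
  moreover have "flux \<delta> (a - K) = 0" using \<open>a \<le> K\<close> by (simp add: flux_def)
  ultimately have "int (rdca_step \<delta> f u n) = int (long_ramp K (flux \<delta> a)
      (a - flux \<delta> a + flux \<delta> (K - a)) (flux \<delta> (K - a)) (n - s + 2))"
    using \<open>a \<le> K\<close> unfolding int_rdca_step assms(1) diff_flow_flux long_ramp_def
    by auto
  then show ?thesis by simp
qed

lemma wave_profile_short_ramp:
  assumes "1 \<le> \<alpha>" and "2 * \<alpha> \<le> K"
  shows "wave_profile K (short_ramp K \<alpha>)"
  unfolding wave_profile_def using assms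
  by (intro exI[of _ 3]) (auto simp: short_ramp_def)

lemma wave_profile_long_ramp:
  assumes "1 \<le> p" and "p \<le> b" and "b \<le> K - q" and "1 \<le> q" and "q < K"
  shows "wave_profile K (long_ramp K p b q)"
  unfolding wave_profile_def using assms
  by (intro exI[of _ 4]) (auto simp: long_ramp_def)

section \<open>The motion of the sharp interface\<close>

context
  fixes \<delta> a K :: nat
  assumes delta: "1 \<le> \<delta>" and a_ge: "2 \<le> a" and K_ge: "a + 2 \<le> K"
begin

lemma wave_profile_sharp: "wave_profile K (short_ramp K (flux \<delta> K))"
  using flux_pos[OF delta, of K] flux_le_half[of \<delta> K] K_ge
  by (intro wave_profile_short_ramp) auto

lemma pinned_sharp_interface:
  assumes "flux \<delta> K < a" and "a < K - flux \<delta> K"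
  shows "pinned_wave (rdca_step \<delta> (fmax a K)) K (short_ramp K (flux \<delta> K))"
proof -
  have "fmax a K (short_ramp K (flux \<delta> K) n) = (if n \<le> 1 then 0 else K)" for n
    using assms K_ge by (auto simp: fmax_def short_ramp_def)
  from rdca_step_sharp_interface[of "fmax a K", OF this] show ?thesis
    by (simp add: pinned_wave_def traveling_wave_def wave_profile_sharp)
qed

lemma advancing_sharp_interface:
  assumes "a < flux \<delta> K"
  shows "traveling_wave (rdca_step \<delta> (fmax a K)) K (-1) (short_ramp K (flux \<delta> K))"
proof -
  have "a < K - flux \<delta> K"
    using assms flux_le_half[of \<delta> K] by linarith
  then have "fmax a K (short_ramp K (flux \<delta> K) n) = (if n \<le> 0 then 0 else K)" for n
    using assms a_ge K_ge by (auto simp: fmax_def short_ramp_def)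
  from rdca_step_sharp_interface[of "fmax a K", OF this] show ?thesis
    by (simp add: traveling_wave_def wave_profile_sharp)
qed

lemma receding_sharp_interface:
  assumes "K - flux \<delta> K < a"
  shows "traveling_wave (rdca_step \<delta> (fmax a K)) K 1 (short_ramp K (flux \<delta> K))"
proof -
  have "flux \<delta> K < a"
    using assms flux_le_half[of \<delta> K] by linarith
  then have "fmax a K (short_ramp K (flux \<delta> K) n) = (if n \<le> 2 then 0 else K)" for n
    using assms a_ge K_ge by (auto simp: fmax_def short_ramp_def)
  from rdca_step_sharp_interface[of "fmax a K", OF this] show ?thesis
    by (simp add: traveling_wave_def wave_profile_sharp)
qed

section \<open>Interfaces with an intermediate cell\<close>

lemma pinned_interface_with_cell:
  assumes "flux \<delta> a = flux \<delta> (K - a)"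
  shows "\<exists>w. pinned_wave (rdca_step \<delta> (fmax a K)) K w"
proof -
  let ?p = "flux \<delta> a" and ?q = "flux \<delta> (K - a)"
  let ?w = "long_ramp K ?p (a - ?p + ?q) ?q"
  have bounds: "1 \<le> ?p" "1 \<le> ?q" "2 * ?p \<le> a" "2 * ?q \<le> K - a"
    using flux_pos[OF delta] flux_le_half a_ge K_ge by auto
  have "fmax a K (?w n) = (if n < 2 then 0 else if n = 2 then a else K)" for n
    using bounds assms a_ge K_ge by (auto simp: fmax_def long_ramp_def)
  from rdca_step_interface_with_cell[of "fmax a K", OF this]
  have "rdca_step \<delta> (fmax a K) ?w n = ?w n" for n
    using K_ge by simp
  moreover have "wave_profile K ?w"
    using bounds assms K_ge by (intro wave_profile_long_ramp) auto
  ultimately show ?thesis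
    by (auto simp: pinned_wave_def traveling_wave_def)
qed

text \<open>
  The cell with value \<open>\<alpha> = a\<close> survives the reaction. It loses \<open>p\<close> to its left and gains \<open>q\<close>
  from its right, so \<open>p < q\<close> lifts it above the threshold: the sharp interface reappears one
  cell further to the left.
\<close>
lemma advancing_two_cycle:
  assumes sharp: "flux \<delta> K = a" and lt: "a < K - a" and gain: "flux \<delta> a < flux \<delta> (K - a)"
  shows "higher_order_wave (rdca_step \<delta> (fmax a K)) K (-1) 2 (short_ramp K (flux \<delta> K))"
proof -
  let ?F = "rdca_step \<delta> (fmax a K)" and ?p = "flux \<delta> a" and ?q = "flux \<delta> (K - a)"
  let ?w = "short_ramp K (flux \<delta> K)"
  have bounds: "2 * ?p \<le> a" "2 * ?q \<le> K - a"
    using flux_le_half by auto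
  have "fmax a K (?w n) = (if n < 1 then 0 else if n = 1 then a else K)" for n
    using a_ge lt unfolding sharp by (auto simp: fmax_def short_ramp_def)
  from rdca_step_interface_with_cell[of "fmax a K", OF this]
  have step: "?F ?w n = long_ramp K ?p (a - ?p + ?q) ?q (n + 1)" for n
    using K_ge by (simp add: add.commute)
  have "fmax a K (?F ?w n) = (if n \<le> 0 then 0 else K)" for n
    unfolding step using bounds gain a_ge K_ge by (auto simp: fmax_def long_ramp_def)
  from rdca_step_sharp_interface[of "fmax a K", OF this] show ?thesis
    by (simp add: higher_order_wave_def numeral_2_eq_2 wave_profile_sharp)
qed

text \<open>
  The mirror image: now the surviving cell is the one with value \<open>K - \<alpha> = a\<close>, and \<open>q < p\<close>
  pushes it below the threshold.
\<close>
lemma receding_two_cycle: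
  assumes sharp: "K - flux \<delta> K = a" and lt: "flux \<delta> K < a" and loss: "flux \<delta> (K - a) < flux \<delta> a"
  shows "higher_order_wave (rdca_step \<delta> (fmax a K)) K 1 2 (short_ramp K (flux \<delta> K))"
proof -
  let ?F = "rdca_step \<delta> (fmax a K)" and ?p = "flux \<delta> a" and ?q = "flux \<delta> (K - a)"
  let ?w = "short_ramp K (flux \<delta> K)"
  have bounds: "2 * ?p \<le> a" "2 * ?q \<le> K - a"
    using flux_le_half by auto
  have "fmax a K (?w n) = (if n < 2 then 0 else if n = 2 then a else K)" for n
    using a_ge K_ge lt sharp by (auto simp: fmax_def short_ramp_def)
  from rdca_step_interface_with_cell[of "fmax a K", OF this]
  have step: "?F ?w n = long_ramp K ?p (a - ?p + ?q) ?q n" for n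
    using K_ge by simp
  have "fmax a K (?F ?w n) = (if n \<le> 2 then 0 else K)" for n
    unfolding step using bounds loss a_ge K_ge by (auto simp: fmax_def long_ramp_def)
  from rdca_step_sharp_interface[of "fmax a K", OF this] show ?thesis
    by (simp add: higher_order_wave_def numeral_2_eq_2 wave_profile_sharp)
qed

text \<open>
  Both the balanced case with \<open>K = 4m - 1\<close> and the unbalanced case at the critical \<open>\<delta>\<close> are
  instances of the following: \<open>\<alpha>\<close> equals the smaller of \<open>a\<close> and \<open>K - a\<close>, and \<open>p \<noteq> q\<close>.
  Since the flux is monotone in the height of the jump, \<open>p \<noteq> q\<close> already forces \<open>a \<noteq> K - a\<close>
  and determines the direction.
\<close>
lemma two_cycle:
  assumes "flux \<delta> K = min a (K - a)" and "flux \<delta> a \<noteq> flux \<delta> (K - a)"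
  shows "\<exists>c\<in>{1, -1}. \<exists>w. higher_order_wave (rdca_step \<delta> (fmax a K)) K c 2 w"
proof (cases "a < K - a")
  case True
  then have "flux \<delta> a \<le> flux \<delta> (K - a)"
    by (simp add: flux_mono)
  with True assms have "flux \<delta> K = a" "flux \<delta> a < flux \<delta> (K - a)" by auto
  with True advancing_two_cycle show ?thesis by blast
next
  case False
  then have "flux \<delta> (K - a) \<le> flux \<delta> a"
    by (simp add: flux_mono)
  moreover from False assms have "K - a \<noteq> a" by metis
  ultimately have "K - flux \<delta> K = a" "flux \<delta> K < a" "flux \<delta> (K - a) < flux \<delta> a"
    using False assms K_ge by auto
  with receding_two_cycle show ?thesis by blast
qed

section \<open>Evaluation of the fluxes\<close>

lemma pinned_wave_small_diffusion:
  assumes "\<delta> < a" and "\<delta> < K - a"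
  shows "\<exists>w. pinned_wave (rdca_step \<delta> (fmax a K)) K w"
  using assms pinned_sharp_interface by (fastforce simp: flux_def)

lemma two_cycle_balanced:
  assumes "a = K div 2 \<or> a = (K + 1) div 2" and "4 dvd K + 1" and "\<delta> \<ge> min a (K - a)"
  shows "\<exists>c\<in>{1, -1}. \<exists>w. higher_order_wave (rdca_step \<delta> (fmax a K)) K c 2 w"
proof (rule two_cycle)
  obtain m where "K + 1 = 4 * m" using assms(2) by (auto elim: dvdE)
  then have K: "K = 4 * m - 1" and m: "m \<ge> 2" using a_ge K_ge by auto
  have "K div 2 = 2 * m - 1" "(K + 1) div 2 = 2 * m" using K m by auto
  then have a: "a = 2 * m - 1 \<and> K - a = 2 * m \<or> a = 2 * m \<and> K - a = 2 * m - 1"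
    using assms(1) K m by auto
  have \<delta>: "\<delta> \<ge> 2 * m - 1" using a assms(3) by auto
  have odd_half: "(2 * m - 1) div 2 = m - 1" and "(4 * m - 1) div 2 = 2 * m - 1"
    using m by auto
  then show "flux \<delta> K = min a (K - a)"
    using a \<delta> K by (auto simp: flux_def)
  have "flux \<delta> (2 * m - 1) = m - 1" "flux \<delta> (2 * m) = m"
    using \<delta> m odd_half by (auto simp: flux_def)
  then show "flux \<delta> a \<noteq> flux \<delta> (K - a)"
    using a m by auto
qed

lemma pinned_wave_balanced:
  assumes "a = K div 2 \<or> a = (K + 1) div 2" and "\<not> 4 dvd K + 1" and "\<delta> \<ge> min a (K - a)"
  shows "\<exists>w. pinned_wave (rdca_step \<delta> (fmax a K)) K w"
proof (rule pinned_interface_with_cell)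
  obtain m r where K: "K = 4 * m + r" and "r < 4"
    by (metis mult_div_mod_eq mod_less_divisor zero_less_numeral)
  have "r \<noteq> 3"
  proof
    assume "r = 3"
    then have "K + 1 = 4 * (m + 1)" using K by simp
    then show False using assms(2) by (metis dvd_triv_left)
  qed
  then have "K = 4 * m \<or> K = 4 * m + 1 \<or> K = 4 * m + 2"
    using K \<open>r < 4\<close> by linarith
  then have "a div 2 = (K - a) div 2" and "a div 2 \<le> min a (K - a)"
    using assms(1) by auto
  then show "flux \<delta> a = flux \<delta> (K - a)"
    using assms(3) by (simp add: flux_def)
qed

text \<open>
  In the unbalanced case \<open>a\<close> and \<open>K - a\<close> differ by at least 2, so their rounded halves differ;
  truncation at \<open>\<delta>\<close> does not hide this, because \<open>\<delta>\<close> exceeds the smaller half.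
\<close>
lemma two_cycle_unbalanced:
  assumes "2 * a + 2 \<le> K \<or> K + 2 \<le> 2 * a" and "\<delta> = min a (K - a)"
  shows "\<exists>c\<in>{1, -1}. \<exists>w. higher_order_wave (rdca_step \<delta> (fmax a K)) K c 2 w"
proof (rule two_cycle)
  show "flux \<delta> K = min a (K - a)"
    using assms K_ge by (auto simp: flux_def min_def)
  show "flux \<delta> a \<noteq> flux \<delta> (K - a)"
    using assms a_ge K_ge unfolding flux_def by linarith
qed

text \<open>
  If \<open>\<delta>\<close> exceeds the smaller of \<open>a\<close> and \<open>K - a\<close>, then so does \<open>\<alpha>\<close>, because half of \<open>K\<close> is larger
  than that number by at least 1. Hence both cells of the ramp lie on the same side of \<open>a\<close>.
\<close>
lemma traveling_wave_unbalanced: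
  assumes "2 * a + 2 \<le> K \<or> K + 2 \<le> 2 * a" and "\<delta> \<ge> min a (K - a) + 1"
  shows "\<exists>c\<in>{1, -1}. \<exists>w. traveling_wave (rdca_step \<delta> (fmax a K)) K c w"
proof (cases "2 * a + 2 \<le> K")
  case True
  then have "a < flux \<delta> K"
    using assms(2) by (auto simp: flux_def)
  with advancing_sharp_interface show ?thesis by blast
next
  case False
  then have "K - flux \<delta> K < a"
    using assms K_ge unfolding flux_def by linarith
  with receding_sharp_interface show ?thesis by blast
qed

end

theorem corollary5p4:
  fixes \<delta> a K :: nat and F :: "(int \<Rightarrow> nat) \<Rightarrow> int \<Rightarrow> nat"
  assumes "\<delta> \<ge> 1" and "2 \<le> a" and "int a \<le> int K - 2"
    and F: "F = rdca_step \<delta> (fmax a K)"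
  shows
    "(int \<delta> \<le> min (int a - 1) (int K - int a - 1) \<longrightarrow> (\<exists>w. pinned_wave F K w)) \<and>
     (int a \<in> {\<lfloor>real K / 2\<rfloor>, \<lceil>real K / 2\<rceil>} \<longrightarrow>
        ((\<exists>m\<ge>1. int K = 4 * int m - 1) \<longrightarrow> int \<delta> \<ge> min (int a) (int K - int a) \<longrightarrow>
           (\<exists>c\<in>{1, -1}. \<exists>w. higher_order_wave F K c 2 w)) \<and>
        (\<not> (\<exists>m\<ge>1. int K = 4 * int m - 1) \<longrightarrow> int \<delta> \<ge> min (int a) (int K - int a) \<longrightarrow>
           (\<exists>w. pinned_wave F K w))) \<and>
     (int a \<notin> {\<lfloor>real K / 2\<rfloor>, \<lceil>real K / 2\<rceil>} \<longrightarrow>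
        (int \<delta> = min (int a) (int K - int a) \<longrightarrow>
           (\<exists>c\<in>{1, -1}. \<exists>w. higher_order_wave F K c 2 w)) \<and>
        (int \<delta> \<ge> min (int a + 1) (int K - int a + 1) \<longrightarrow>
           (\<exists>c\<in>{1, -1}. \<exists>w. traveling_wave F K c w)))"
proof -
  have K: "a + 2 \<le> K" using assms(3) by linarith
  note lems = pinned_wave_small_diffusion[OF assms(1,2) K] two_cycle_balanced[OF assms(1,2) K]
    pinned_wave_balanced[OF assms(1,2) K] two_cycle_unbalanced[OF assms(1,2) K]
    traveling_wave_unbalanced[OF assms(1,2) K]
  have "\<lfloor>real K / 2\<rfloor> = int (K div 2)"
    using floor_divide_of_nat_eq[of K 2, where ?'a = real] by simp
  moreover have "\<lceil>real K / 2\<rceil> = int ((K + 1) div 2)"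
  proof -
    consider j where "K = 2 * j" | j where "K = 2 * j + 1" by (meson oddE evenE)
    then show ?thesis by cases (auto simp: ceiling_unique)
  qed
  ultimately have balanced: "int a \<in> {\<lfloor>real K / 2\<rfloor>, \<lceil>real K / 2\<rceil>} \<longleftrightarrow>
      a = K div 2 \<or> a = (K + 1) div 2"
    by (simp only: insert_iff empty_iff of_nat_eq_iff) simp
  have unbalanced: "int a \<notin> {\<lfloor>real K / 2\<rfloor>, \<lceil>real K / 2\<rceil>} \<longleftrightarrow>
      2 * a + 2 \<le> K \<or> K + 2 \<le> 2 * a"
    unfolding balanced by linarith
  have residue: "(\<exists>m\<ge>1. int K = 4 * int m - 1) \<longleftrightarrow> 4 dvd K + 1"
  proof
    assume "\<exists>m\<ge>1. int K = 4 * int m - 1"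
    then obtain m where "int K = 4 * int m - 1" by blast
    then have "K + 1 = 4 * m" by linarith
    then show "4 dvd K + 1" by (metis dvd_triv_left)
  next
    assume "4 dvd K + 1"
    then obtain m where "K + 1 = 4 * m" by (auto elim: dvdE)
    then show "\<exists>m\<ge>1. int K = 4 * int m - 1" by (intro exI[of _ m]) auto
  qed
  have critical: "int \<delta> \<ge> min (int a) (int K - int a) \<longleftrightarrow> \<delta> \<ge> min a (K - a)"
    "int \<delta> = min (int a) (int K - int a) \<longleftrightarrow> \<delta> = min a (K - a)"
    "int \<delta> \<ge> min (int a + 1) (int K - int a + 1) \<longleftrightarrow> \<delta> \<ge> min a (K - a) + 1"
    "int \<delta> \<le> min (int a - 1) (int K - int a - 1) \<longleftrightarrow> \<delta> < a \<and> \<delta> < K - a"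
    using K by (auto simp: min_def)
  show ?thesis
    unfolding F unbalanced unfolding balanced residue critical
    using lems by blast
qed

end
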